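(* Let $A\in\mathbb{R}^{n\times n}$ be a non-singular matrix, and suppose there exist non-singular matrices $P,Q\in\mathbb{R}^{n\times n}$ such that $A=PHQ$, where $H\in\mathbb{R}^{n\times n}$ is symmetric positive definite. Let $M=PGQ$, where $G\in\mathbb{R}^{n\times n}$ is symmetric positive definite, and let $W=Q^{-1}P^T$. Let $b\in\mathbb{R}^n$ and let $x^*$ be the solution of $Ax=b$. If the RPCG method (restrictively preconditioned conjugate gradient method) started from an initial vector $x_0\in\mathbb{R}^n$ generates the approximate solution $x_k$ to $Ax=b$ after $k$ iterations, then $$\left\|x_k-x^*\right\|_{W^{-T}A}\leqslant 2\left(\frac{\sqrt{\kappa(M^{-1}A)}-1}{\sqrt{\kappa(M^{-1}A)}+1}\right)^k\left\|x_0-x^*\right\|_{W^{-T}A},$$ where $\kappa(M^{-1}A)$ is the Euclidean condition number of the matrix $M^{-1}A$.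
   Context: For a symmetric positive definite matrix $X\in\mathbb{R}^{n\times n}$ and $x\in\mathbb{R}^n$, $\|x\|_X=\sqrt{x^TXx}$. The notation $W^{-T}$ means $(W^{-1})^T$; here $W^{-T}A=Q^THQ$ is symmetric positive definite. The Euclidean condition number of a non-singular matrix $Y$ is $\kappa(Y)=\|Y\|_2\|Y^{-1}\|_2$. RPCG method for $Ax=b$, with $A=PHQ$, $M=PGQ$, $W=Q^{-1}P^T$: given $x_0\in\mathbb{R}^n$, set $r_0=b-Ax_0$, $z_0=M^{-1}r_0$, $p_0=z_0$, $v_0=W^{-1}z_0$, $q_0=v_0$. For $k=0,1,2,\dots$ (stopping if $r_k=0$), compute $$\alpha_k=-\frac{v_k^Tr_k}{q_k^TAp_k},\quad x_{k+1}=x_k-\alpha_kp_k,\quad r_{k+1}=r_k+\alpha_kAp_k,\quad z_{k+1}=M^{-1}r_{k+1},\quad v_{k+1}=W^{-1}z_{k+1},$$ $$\beta_k=\frac{v_{k+1}^Tr_{k+1}}{v_k^Tr_k},\quad p_{k+1}=z_{k+1}+\beta_kp_k,\quad q_{k+1}=v_{k+1}+\beta_kq_k.$$ Equivalently, writing $G=S^TS$ with $S\in\mathbb{R}^{n\times n}$ non-singular, the RPCG method is the standard conjugate gradient method applied to the symmetric positive definite system $\mathbf{R}\mathbf{x}=\mathbf{b}$ with $\mathbf{R}=(PS^T)^{-1}A(SQ)^{-1}=S^{-T}HS^{-1}$ and $\mathbf{b}=(PS^T)^{-1}b$, started at $\mathbf{x}_0=SQx_0$, with iterates related by $\mathbf{x}_k=SQx_k$.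 *)

theory Defs
  imports "HOL-Analysis.Analysis"
begin

definition spd :: "real^'n^'n \<Rightarrow> bool" where
  "spd X \<longleftrightarrow> transpose X = X \<and> (\<forall>x. x \<noteq> 0 \<longrightarrow> 0 < x \<bullet> (X *v x))"

definition energy_norm :: "real^'n^'n \<Rightarrow> real^'n \<Rightarrow> real" where
  "energy_norm X x = sqrt (x \<bullet> (X *v x))"

text \<open>
  The norm on \<^typ>\<open>real^'n\<close> is Euclidean, so \<^const>\<open>onorm\<close> gives the spectral norm
  of a matrix.
\<close>
definition cond2 :: "real^'n^'n \<Rightarrow> real" where
  "cond2 Y = onorm ((*v) Y) * onorm ((*v) (matrix_inv Y))"

text \<open>
  The sequences are produced by the first \<open>k\<close> iterations of RPCG for \<open>A x = b\<close>, started from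
  \<open>x 0\<close>. The condition \<open>r j \<noteq> 0\<close> for \<open>j < k\<close> says that the method has not stopped before
  completing \<open>k\<close> iterations; values beyond those iterations are left unconstrained.
\<close>
definition rpcg_run ::
  "real^'n^'n \<Rightarrow> real^'n^'n \<Rightarrow> real^'n^'n \<Rightarrow> real^'n \<Rightarrow> nat \<Rightarrow>
   (nat \<Rightarrow> real^'n) \<Rightarrow> (nat \<Rightarrow> real^'n) \<Rightarrow> (nat \<Rightarrow> real^'n) \<Rightarrow> (nat \<Rightarrow> real^'n) \<Rightarrow>
   (nat \<Rightarrow> real^'n) \<Rightarrow> (nat \<Rightarrow> real^'n) \<Rightarrow> (nat \<Rightarrow> real) \<Rightarrow> (nat \<Rightarrow> real) \<Rightarrow> bool" where
  "rpcg_run A M W b k x r z v p q \<alpha> \<beta> \<longleftrightarrow>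
     r 0 = b - A *v x 0 \<and>
     z 0 = matrix_inv M *v r 0 \<and>
     p 0 = z 0 \<and>
     v 0 = matrix_inv W *v z 0 \<and>
     q 0 = v 0 \<and>
     (\<forall>j<k. r j \<noteq> 0 \<and>
        \<alpha> j = - ((v j \<bullet> r j) / (q j \<bullet> (A *v p j))) \<and>
        x (Suc j) = x j - \<alpha> j *\<^sub>R p j \<and>
        r (Suc j) = r j + \<alpha> j *\<^sub>R (A *v p j) \<and>
        z (Suc j) = matrix_inv M *v r (Suc j) \<and>
        v (Suc j) = matrix_inv W *v z (Suc j) \<and>
        \<beta> j = (v (Suc j) \<bullet> r (Suc j)) / (v j \<bullet> r j) \<and>
        p (Suc j) = z (Suc j) + \<beta> j *\<^sub>R p j \<and>
        q (Suc j) = v (Suc j) + \<beta> j *\<^sub>R q j)"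

end

theory Submission imports Defs
begin

text \<open>
  Put \<open>K = W\<^sup>-\<^sup>T A = Q\<^sup>T H Q\<close>, \<open>N = W\<^sup>-\<^sup>T M = Q\<^sup>T G Q\<close> and \<open>T = M\<^sup>-\<^sup>1 A\<close>, so \<open>N T = K\<close>. In these
  terms RPCG is the conjugate gradient method for \<open>K\<close> preconditioned by \<open>N\<close>, and the error \<open>e\<^sub>k\<close>
  has the least \<open>K\<close>-norm among all \<open>f(T) e\<^sub>0\<close> with \<open>f\<close> a polynomial of degree at most \<open>k\<close>
  and \<open>f(0) = 1\<close>. As \<open>T\<close> is \<open>K\<close>-self-adjoint with
  \<open>K\<close>-spectrum between \<open>\<sigma>\<^sup>2 = 1 / \<parallel>T\<^sup>-\<^sup>1\<parallel>\<close> and \<open>\<tau>\<^sup>2 = \<parallel>T\<parallel>\<close>, a shifted Chebyshev polynomial gives the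
  rate. No spectral theorem is needed: \<open>\<parallel>T\<^sub>k(Y) e\<parallel> \<le> \<parallel>e\<parallel>\<close> for a self-adjoint contraction \<open>Y\<close> follows
  from the Pell identity \<open>T\<^sub>k(Y)\<^sup>2 + (1 - Y\<^sup>2) U\<^sub>k\<^sub>-\<^sub>1(Y)\<^sup>2 = 1\<close>.
\<close>

section \<open>Bilinear forms of matrices and positive definiteness\<close>

definition mip :: "real^'n^'n \<Rightarrow> real^'n \<Rightarrow> real^'n \<Rightarrow> real" where
  "mip X u w = u \<bullet> (X *v w)"

lemma mip_add_left: "mip X (u + u') w = mip X u w + mip X u' w"
  and mip_add_right: "mip X u (w + w') = mip X u w + mip X u w'"
  and mip_diff_left: "mip X (u - u') w = mip X u w - mip X u' w"
  and mip_diff_right: "mip X u (w - w') = mip X u w - mip X u w'"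
  and mip_scaleR_left: "mip X (c *\<^sub>R u) w = c * mip X u w"
  and mip_scaleR_right: "mip X u (c *\<^sub>R w) = c * mip X u w"
  and mip_zero_left [simp]: "mip X 0 w = 0"
  and mip_zero_right [simp]: "mip X u 0 = 0"
  by (simp_all add: mip_def inner_add_left inner_add_right inner_diff_left inner_diff_right
      matrix_vector_right_distrib matrix_vector_mult_diff_distrib matrix_vector_mult_scaleR)

lemmas mip_bilinear = mip_add_left mip_add_right mip_diff_left mip_diff_right
  mip_scaleR_left mip_scaleR_right

lemma mip_mult: "mip (X ** Y) u w = mip X u (Y *v w)"
  by (simp add: mip_def matrix_vector_mul_assoc)

lemma mip_transpose: "mip (transpose X) u w = mip X w u"
  by (metis mip_def transpose_matrix_vector dot_lmul_matrix inner_commute)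

lemma mip_commute: "transpose X = X \<Longrightarrow> mip X u w = mip X w u"
  by (metis mip_transpose)

lemma spd_commute: "spd X \<Longrightarrow> mip X u w = mip X w u"
  by (simp add: spd_def mip_commute)

lemma spd_pos: "spd X \<Longrightarrow> u \<noteq> 0 \<Longrightarrow> 0 < mip X u u"
  by (simp add: spd_def mip_def)

lemma spd_nonneg: "spd X \<Longrightarrow> 0 \<le> mip X u u"
  by (cases "u = 0") (auto dest: spd_pos[of X u])

lemma spd_congruence:
  fixes X Q :: "real^'n^'n"
  assumes "spd X" "invertible Q"
  shows "spd (transpose Q ** X ** Q)"
proof -
  have form: "u \<bullet> ((transpose Q ** X ** Q) *v u) = mip X (Q *v u) (Q *v u)" for u
    by (metis mip_def matrix_vector_mul_assoc dot_lmul_matrix transpose_matrix_vector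
        transpose_transpose)
  have "Q *v u \<noteq> 0" if "u \<noteq> 0" for u
    using that assms(2) by (metis invertible_def matrix_vector_mul_assoc matrix_vector_mul_lid
        matrix_vector_mult_0_right)
  then show ?thesis
    using assms(1) unfolding spd_def form
    by (auto simp: mip_def matrix_transpose_mul matrix_mul_assoc)
qed

section \<open>Extreme values of quadratic forms and operator norms\<close>

lemma psd_null_vector:
  assumes sym: "transpose B = B" and psd: "\<And>u. 0 \<le> mip B u u" and null: "mip B w w = 0"
  shows "B *v w = 0"
proof -
  define u where "u = B *v w"
  define g where "g = u \<bullet> u"
  define h where "h = mip B u u"
  \<comment> \<open>The form at \<open>w + t *\<^sub>R u\<close> is
    \<open>2 * t * g + t\<^sup>2 * h\<close>. This \<open>t\<close> makes it negative unless
    \<open>g = 0\<close>; the added 1 covers \<open>h = 0\<close>.\<close>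
  define t where "t = - g / (h + 1)"
  have h: "h \<ge> 0"
    using psd by (simp add: h_def)
  have "0 \<le> mip B (w + t *\<^sub>R u) (w + t *\<^sub>R u)"
    by (rule psd)
  also have "\<dots> = 2 * t * g + t\<^sup>2 * h"
    using null mip_commute[OF sym, of w u]
    by (simp add: mip_bilinear g_def h_def u_def power2_eq_square algebra_simps)
      (simp add: mip_def)
  also have "\<dots> = - (g\<^sup>2 * (h + 2) / (h + 1)\<^sup>2)"
    using h by (simp add: t_def power2_eq_square divide_simps) (simp add: algebra_simps)
  finally have "g\<^sup>2 * (h + 2) / (h + 1)\<^sup>2 \<le> 0"
    by simp
  then have "g\<^sup>2 \<le> 0"
    using h by (simp add: divide_le_0_iff mult_le_0_iff power2_eq_square)
  then show ?thesis
    by (simp add: g_def u_def)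
qed

text \<open>By compactness the Rayleigh quotient has a maximiser \<open>w\<close> on the sphere.
  With \<open>l\<close> its maximum, the form of \<open>l *\<^sub>R K - L\<close> is nonnegative and
  vanishes at \<open>w\<close>, so \<open>psd_null_vector\<close> yields the eigenvalue equation
  without differentiation.\<close>

lemma generalized_rayleigh_max:
  fixes K L :: "real^'n^'n"
  assumes K: "spd K" and L: "transpose L = L"
  obtains l w where "w \<noteq> 0" "L *v w = l *\<^sub>R (K *v w)" "\<And>u. mip L u u \<le> l * mip K u u"
proof -
  let ?S = "sphere (0 :: real^'n) 1"
  let ?f = "\<lambda>u. mip L u u / mip K u u"
  have "continuous_on ?S ?f"
    unfolding mip_def
  proof (intro continuous_intros matrix_vector_mult_linear_continuous_on ballI)
    fix u :: "real^'n" assume "u \<in> ?S"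
    then show "u \<bullet> (K *v u) \<noteq> 0"
      using spd_pos[OF K, of u] by (force simp: mip_def)
  qed
  moreover have "?S \<noteq> {}"
    using vector_choose_size[of 1] by auto
  ultimately obtain w where w: "w \<in> ?S" and max: "\<And>u. u \<in> ?S \<Longrightarrow> ?f u \<le> ?f w"
    using continuous_attains_sup[of ?S ?f] by auto
  have w0: "w \<noteq> 0"
    using w by auto
  have le: "mip L u u \<le> ?f w * mip K u u" for u
  proof (cases "u = 0")
    case False
    have "?f u = ?f ((1 / norm u) *\<^sub>R u)"
      using False by (simp add: mip_bilinear)
    also have "\<dots> \<le> ?f w"
      using False by (intro max) simp
    finally show ?thesis
      using spd_pos[OF K False] by (simp add: pos_divide_le_eq)
  qed simp
  let ?B = "?f w *\<^sub>R K - L"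
  have form: "mip ?B u v = ?f w * mip K u v - mip L u v" for u v
    by (simp add: mip_def matrix_vector_mult_diff_rdistrib inner_diff_right
        scaleR_matrix_vector_assoc[symmetric])
  have "?B *v w = 0"
  proof (rule psd_null_vector)
    show "transpose ?B = ?B"
      using K L by (auto simp: spd_def transpose_def vec_eq_iff)
    show "0 \<le> mip ?B u u" for u
      using le[of u] by (simp add: form)
    show "mip ?B w w = 0"
      using spd_pos[OF K w0] by (simp add: form)
  qed
  then have "L *v w = ?f w *\<^sub>R (K *v w)"
    by (simp add: matrix_vector_mult_diff_rdistrib scaleR_matrix_vector_assoc[symmetric])
  then show ?thesis
    using w0 le that by blast
qed

lemma spd_inj:
  assumes "spd X" "X *v u = X *v w"
  shows "u = w"
proof (rule ccontr)
  assume "u \<noteq> w"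
  then have "0 < mip X (u - w) (u - w)"
    using spd_pos[OF assms(1), of "u - w"] by simp
  then show False
    using assms(2) by (simp add: mip_def matrix_vector_mult_diff_distrib)
qed

text \<open>The operator norms in the next two lemmas are Euclidean although \<open>T\<close> is self-adjoint for
  \<open>K\<close>: the extreme value of the form is an eigenvalue, so every operator norm bounds it.\<close>

lemma selfadjoint_le_onorm:
  fixes K T :: "real^'n^'n"
  assumes K: "spd K" and sym: "transpose (K ** T) = K ** T"
  shows "mip K u (T *v u) \<le> onorm ((*v) T) * mip K u u"
proof -
  obtain l w where w: "w \<noteq> 0" "(K ** T) *v w = l *\<^sub>R (K *v w)"
    and l: "\<And>u. mip (K ** T) u u \<le> l * mip K u u"
    using generalized_rayleigh_max[OF K sym] by blast
  have "K *v (T *v w) = K *v (l *\<^sub>R w)"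
    using w(2) by (simp add: matrix_vector_mul_assoc matrix_vector_mult_scaleR)
  then have "T *v w = l *\<^sub>R w"
    by (rule spd_inj[OF K])
  then have "\<bar>l\<bar> * norm w \<le> onorm ((*v) T) * norm w"
    using onorm[OF matrix_vector_mul_bounded_linear, of T w] by simp
  then have "l \<le> onorm ((*v) T)"
    using w(1) by simp
  then show ?thesis
    using l[of u] mult_right_mono[of l "onorm ((*v) T)" "mip K u u"] spd_nonneg[OF K, of u]
    by (simp add: mip_mult)
qed

lemma selfadjoint_ge_onorm_inverse:
  fixes K T S :: "real^'n^'n"
  assumes K: "spd K" and sym: "transpose (K ** T) = K ** T"
    and pos: "\<And>u. 0 \<le> mip K u (T *v u)" and S: "S ** T = mat 1"
  shows "mip K u u \<le> onorm ((*v) S) * mip K u (T *v u)"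
proof -
  have uminus_mult: "(- X) *v u = - (X *v u)" for X :: "real^'n^'n" and u
    by (simp add: matrix_vector_mult_def vec_eq_iff sum_negf)
  have "transpose (- (K ** T)) = - (K ** T)"
    using sym by (simp add: transpose_def vec_eq_iff)
  then obtain l w where w: "w \<noteq> 0" "(- (K ** T)) *v w = l *\<^sub>R (K *v w)"
    and l: "\<And>u. mip (- (K ** T)) u u \<le> l * mip K u u"
    using generalized_rayleigh_max[OF K] by blast
  \<comment> \<open>The negated maximum for the negated form is the smallest eigenvalue of
    \<open>T\<close>.\<close>
  define m where "m = - l"
  have "K *v (T *v w) = - (l *\<^sub>R (K *v w))"
    by (simp add: matrix_vector_mul_assoc uminus_mult flip: w(2))
  also have "\<dots> = K *v (m *\<^sub>R w)"
    by (simp add: m_def matrix_vector_mult_scaleR del: scaleR_minus_left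
        flip: scaleR_minus_left)
  finally have Tw: "T *v w = m *\<^sub>R w"
    by (rule spd_inj[OF K])
  have m: "m * mip K u u \<le> mip K u (T *v u)" for u
    using l[of u] by (simp add: m_def mip_mult[symmetric]) (simp add: mip_def uminus_mult)
  have "0 \<le> m * mip K w w"
    using pos[of w] by (simp add: Tw mip_bilinear)
  then have m0: "0 \<le> m"
    using spd_pos[OF K w(1)] by (simp add: zero_le_mult_iff)
  have "w = m *\<^sub>R (S *v w)"
    using S Tw by (metis matrix_vector_mul_assoc matrix_vector_mul_lid matrix_vector_mult_scaleR)
  then have "norm w = m * norm (S *v w)"
    using m0 by (metis abs_of_nonneg norm_scaleR)
  also have "\<dots> \<le> m * (onorm ((*v) S) * norm w)"
    using m0 by (intro mult_left_mono onorm matrix_vector_mul_bounded_linear)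
  finally have "1 * norm w \<le> onorm ((*v) S) * m * norm w"
    by (simp add: mult_ac)
  then have "1 \<le> onorm ((*v) S) * m"
    using w(1) by simp
  then have "mip K u u \<le> onorm ((*v) S) * m * mip K u u"
    using mult_right_mono[of 1 "onorm ((*v) S) * m"] spd_nonneg[OF K, of u] by fastforce
  also have "\<dots> \<le> onorm ((*v) S) * mip K u (T *v u)"
    using mult_left_mono[OF m onorm_pos_le[OF matrix_vector_mul_bounded_linear, of S]]
    by (simp add: mult_ac)
  finally show ?thesis .
qed

text \<open>Polarization: the bounds at \<open>u + w\<close> and \<open>u - w\<close>, added by the
  parallelogram law, control \<open>mip K w (Y *v u)\<close>; then \<open>w\<close> is taken along
  \<open>Y *v u\<close>.\<close>

lemma selfadjoint_norm_le:
  fixes K Y :: "real^'n^'n"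
  assumes K: "spd K" and sym: "transpose (K ** Y) = K ** Y" and d: "0 \<le> d"
    and bound: "\<And>u. \<bar>mip K u (Y *v u)\<bar> \<le> d * mip K u u"
  shows "mip K (Y *v u) (Y *v u) \<le> d\<^sup>2 * mip K u u"
proof -
  have polar: "2 * mip K w (Y *v u) \<le> d * (mip K u u + mip K w w)" for w
  proof -
    have "mip K u (Y *v w) = mip K w (Y *v u)"
      using mip_commute[OF sym] by (simp add: mip_mult)
    moreover have "mip K (u + w) (Y *v (u + w)) - mip K (u - w) (Y *v (u - w))
        \<le> d * mip K (u + w) (u + w) + d * mip K (u - w) (u - w)"
      using bound[of "u + w"] bound[of "u - w"] by linarith
    ultimately show ?thesis
      by (simp add: mip_bilinear matrix_vector_right_distrib matrix_vector_mult_diff_distrib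
          algebra_simps)
  qed
  show ?thesis
  proof (cases "d = 0")
    case True
    then show ?thesis
      using polar[of "Y *v u"] by simp
  next
    case False
    \<comment> \<open>With g the squared \<open>K\<close>-norm of \<open>Y *v u\<close>, the choice
      \<open>w = (1 / d) *\<^sub>R (Y *v u)\<close> gives 2 g / d on the left and only g / d on the
      right.\<close>
    then show ?thesis
      using d polar[of "(1 / d) *\<^sub>R (Y *v u)"]
      by (simp add: mip_bilinear power2_eq_square field_simps)
  qed
qed


section \<open>Scaled Chebyshev polynomials\<close>

text \<open>With \<open>D = d\<^sup>2\<close> this is the pair \<open>(d\<^sup>j T\<^sub>j(Y/d), d\<^sup>j\<^sup>-\<^sup>1 U\<^sub>j\<^sub>-\<^sub>1(Y/d))\<close> of
  Chebyshev polynomials applied to \<open>e\<close>, scaled so that \<open>d = 0\<close> is allowed.\<close>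
fun cheb :: "('a::real_vector \<Rightarrow> 'a) \<Rightarrow> real \<Rightarrow> 'a \<Rightarrow> nat \<Rightarrow> 'a \<times> 'a" where
  "cheb Y D e 0 = (e, 0)"
| "cheb Y D e (Suc j) =
    (let (c, u) = cheb Y D e j; u' = Y u + c in (Y u' - D *\<^sub>R u, u'))"

text \<open>Each step of the recurrence multiplies the left side by \<open>D\<close>, as
  self-adjointness makes the cross terms cancel. If \<open>D = d\<^sup>2\<close> and
  \<open>Y\<close> has \<open>K\<close>-norm at most \<open>d\<close>, the \<open>u\<close> terms
  are together nonnegative, which bounds \<open>c\<close>.\<close>

lemma cheb_pell:
  assumes K: "spd K" and sym: "transpose (K ** Y) = K ** Y" and "cheb ((*v) Y) D e j = (c, u)"
  shows "mip K c c + D * mip K u u - mip K (Y *v u) (Y *v u) = D ^ j * mip K e e"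
  using assms(3)
proof (induction j arbitrary: c u)
  case (Suc j)
  obtain c\<^sub>0 u\<^sub>0 where prev: "cheb ((*v) Y) D e j = (c\<^sub>0, u\<^sub>0)"
    by fastforce
  have u: "u = Y *v u\<^sub>0 + c\<^sub>0" and c: "c = Y *v u - D *\<^sub>R u\<^sub>0"
    using Suc.prems prev by (auto simp: Let_def)
  have self: "mip K (Y *v u) u\<^sub>0 = mip K u (Y *v u\<^sub>0)"
    using mip_commute[OF sym] spd_commute[OF K] by (metis mip_mult)
  have "mip K c c + D * mip K u u - mip K (Y *v u) (Y *v u)
      = D * (mip K u u - 2 * mip K u (Y *v u\<^sub>0) + D * mip K u\<^sub>0 u\<^sub>0)"
    using self spd_commute[OF K, of "Y *v u" u\<^sub>0] by (simp add: c mip_bilinear algebra_simps)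
  also have "\<dots> = D * (mip K c\<^sub>0 c\<^sub>0 + D * mip K u\<^sub>0 u\<^sub>0 - mip K (Y *v u\<^sub>0) (Y *v u\<^sub>0))"
    using spd_commute[OF K, of "Y *v u\<^sub>0" c\<^sub>0] by (simp add: u mip_bilinear algebra_simps)
  also have "\<dots> = D ^ Suc j * mip K e e"
    using Suc.IH[OF prev] by simp
  finally show ?case .
qed simp

text \<open>The recurrence multiplies \<open>c + t * u\<close> by \<open>s + t\<close>. Using both
  roots \<open>t\<close> expresses \<open>c\<close> as the mean of two powers.\<close>

lemma cheb_real:
  fixes s t D :: real
  assumes "t\<^sup>2 = s\<^sup>2 - D" "cheb ((*) s) D 1 j = (c, u)"
  shows "c + t * u = (s + t) ^ j"
  using assms(2)
proof (induction j arbitrary: c u)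
  case (Suc j)
  obtain c\<^sub>0 u\<^sub>0 where prev: "cheb ((*) s) D 1 j = (c\<^sub>0, u\<^sub>0)"
    by fastforce
  have "u = s * u\<^sub>0 + c\<^sub>0" "c = s * u - D * u\<^sub>0"
    using Suc.prems prev by (auto simp: Let_def)
  then have "c + t * u = (s + t) * (c\<^sub>0 + t * u\<^sub>0) + (s\<^sup>2 - D - t\<^sup>2) * u\<^sub>0"
    by (simp add: algebra_simps power2_eq_square)
  then show ?case
    using Suc.IH[OF prev] assms(1) by simp
qed simp

section \<open>Preconditioned conjugate gradients: orthogonality and conjugacy\<close>

text \<open>\<open>e\<close> is the error and \<open>z\<close> the preconditioned residual, so the residual itself, up to the factor
  \<open>W\<^sup>-\<^sup>T\<close> in RPCG, is \<open>K e = N z\<close>.\<close>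
locale preconditioned_cg =
  fixes K N T :: "real^'n^'n" and k :: nat and e z p :: "nat \<Rightarrow> real^'n" and a \<beta> :: "nat \<Rightarrow> real"
  assumes K: "spd K" and N: "spd N" and NT: "N ** T = K"
    and z_eq: "\<And>j. j \<le> k \<Longrightarrow> z j = T *v e j"
    and e_nonzero: "\<And>j. j < k \<Longrightarrow> e j \<noteq> 0"
    and p_0: "p 0 = z 0"
    and a_eq: "\<And>j. j < k \<Longrightarrow> a j = mip N (z j) (z j) / mip K (p j) (p j)"
    and e_Suc: "\<And>j. j < k \<Longrightarrow> e (Suc j) = e j - a j *\<^sub>R p j"
    and b_eq: "\<And>j. j < k \<Longrightarrow> \<beta> j = mip N (z (Suc j)) (z (Suc j)) / mip N (z j) (z j)"
    and p_Suc: "\<And>j. j < k \<Longrightarrow> p (Suc j) = z (Suc j) + \<beta> j *\<^sub>R p j"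
begin

lemma mip_N_T: "mip N u (T *v w) = mip K u w"
  by (simp add: NT flip: mip_mult)

text \<open>\<open>K ** T\<close> equals \<open>transpose T ** N ** T\<close>, which also makes its
  form nonnegative.\<close>

lemma T_selfadjoint: "transpose (K ** T) = K ** T"
proof -
  have "transpose T ** N = K"
    using K N NT by (metis matrix_transpose_mul spd_def)
  then show ?thesis
    using K NT by (metis matrix_transpose_mul matrix_mul_assoc spd_def)
qed

lemma T_pos: "0 \<le> mip K u (T *v u)"
  using spd_nonneg[OF N, of "T *v u"] spd_commute[OF K] spd_commute[OF N]
  by (metis mip_N_T)

lemma z_Suc: "j < k \<Longrightarrow> z (Suc j) = z j - a j *\<^sub>R (T *v p j)"
  by (simp add: z_eq e_Suc matrix_vector_mult_diff_distrib matrix_vector_mult_scaleR)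

lemma residual_pos:
  assumes "j < k"
  shows "0 < mip N (z j) (z j)"
proof -
  have "z j \<noteq> 0"
  proof
    assume "z j = 0"
    then have "mip K (e j) (e j) = 0"
      using assms mip_N_T[of "e j" "e j"] by (simp add: z_eq)
    then show False
      using spd_pos[OF K e_nonzero[OF assms]] by simp
  qed
  then show ?thesis
    by (rule spd_pos[OF N])
qed

text \<open>Orthogonality is a hypothesis because this fact is used inside the induction that proves
  it.\<close>

lemma direction_residual_self:
  assumes "j \<le> k" "\<And>i. i < j \<Longrightarrow> mip N (p i) (z j) = 0"
  shows "mip N (p j) (z j) = mip N (z j) (z j)"
proof (cases j)
  case (Suc i)
  then show ?thesis
    using assms by (simp add: p_Suc mip_bilinear)
qed (simp add: p_0)

lemma conjugate_pos_if_orthogonal: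
  assumes "j < k" "\<And>i. i < j \<Longrightarrow> mip N (p i) (z j) = 0"
  shows "0 < mip K (p j) (p j)"
proof -
  have "mip N (p j) (z j) \<noteq> 0"
    using direction_residual_self[of j] residual_pos[of j] assms by simp
  then have "p j \<noteq> 0"
    by auto
  then show ?thesis
    by (rule spd_pos[OF K])
qed

text \<open>The new residual needs the old conjugacy, and the new direction needs the orthogonality
  of the new residual, so one induction proves both. At the last index, \<open>a j\<close> and
  \<open>\<beta> j\<close> are chosen to make the products vanish.\<close>

lemma orthogonality:
  assumes "j \<le> k"
  shows "\<forall>i<j. mip N (p i) (z j) = 0 \<and> mip K (p i) (p j) = 0"
  using assms
proof (induction j rule: less_induct)
  case (less n)
  show ?case
  proof (cases n)
    case (Suc j)
    then have jk: "j < k"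
      using less.prems by simp
    have IH: "mip N (p i) (z l) = 0" "mip K (p i) (p l) = 0" if "i < l" "l \<le> j" for i l
      using less.IH[of l] that jk Suc by auto
    have pp: "0 < mip K (p l) (p l)" if "l \<le> j" for l
      using that jk IH by (intro conjugate_pos_if_orthogonal) auto
    have a_pos: "0 < a l" if "l \<le> j" for l
      using that jk pp residual_pos by (simp add: a_eq)
    have pz: "mip N (p i) (z (Suc j)) = 0" if "i < Suc j" for i
    proof (cases "i = j")
      case True
      then show ?thesis
        using jk pp[of j] direction_residual_self[of j] IH
        by (simp add: z_Suc mip_bilinear mip_N_T a_eq)
    next
      case False
      then show ?thesis
        using jk IH that by (simp add: z_Suc mip_bilinear mip_N_T)
    qed
    have zz: "mip N (z i) (z (Suc j)) = 0" if "i \<le> j" for i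
    proof (cases i)
      case 0
      then show ?thesis
        using pz[of 0] by (simp add: p_0)
    next
      case (Suc l)
      then have "z i = p i - \<beta> l *\<^sub>R p l"
        using jk that by (simp add: p_Suc)
      then show ?thesis
        using pz[of i] pz[of l] Suc that by (simp add: mip_bilinear)
    qed
    \<comment> \<open>As \<open>a i *\<^sub>R (T *v p i)\<close> is a difference of consecutive
      \<open>z\<close>, conjugacy reduces to orthogonality of the \<open>z\<close>. For
      \<open>i < j\<close> both terms vanish; for \<open>i = j\<close> the second remains and is
      what \<open>\<beta> j\<close> cancels.\<close>
    have step: "a i * mip K (p i) (z (Suc j))
          = mip N (z i) (z (Suc j)) - mip N (z (Suc i)) (z (Suc j))"
      if "i \<le> j" for i
    proof -
      have "a i *\<^sub>R (T *v p i) = z i - z (Suc i)"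
        using that jk by (simp add: z_Suc)
      then have "a i * mip N (T *v p i) (z (Suc j))
          = mip N (z i) (z (Suc j)) - mip N (z (Suc i)) (z (Suc j))"
        by (metis mip_diff_left mip_scaleR_left)
      then show ?thesis
        by (metis mip_N_T spd_commute[OF K] spd_commute[OF N])
    qed
    have pp_Suc: "mip K (p i) (p (Suc j)) = 0" if "i < Suc j" for i
    proof (cases "i = j")
      case True
      have "a j * mip K (p j) (p (Suc j))
          = a j * mip K (p j) (z (Suc j)) + \<beta> j * (a j * mip K (p j) (p j))"
        using jk by (simp add: p_Suc mip_bilinear algebra_simps)
      also have "\<dots> = 0"
        using jk pp[of j] residual_pos[of j] step[of j] zz[of j] by (simp add: a_eq b_eq)
      finally show ?thesis
        using True a_pos[of j] by simp
    next
      case False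
      then have "a i * mip K (p i) (z (Suc j)) = 0"
        using that step[of i] zz[of i] zz[of "Suc i"] by simp
      then show ?thesis
        using False that jk IH(2)[of i j] a_pos[of i] by (simp add: p_Suc mip_bilinear)
    qed
    show ?thesis
      using Suc pz pp_Suc by simp
  qed simp
qed

lemma pp_pos: "j < k \<Longrightarrow> 0 < mip K (p j) (p j)"
  using orthogonality by (intro conjugate_pos_if_orthogonal) auto

lemma a_pos: "j < k \<Longrightarrow> 0 < a j"
  using pp_pos residual_pos by (simp add: a_eq)

section \<open>Krylov spaces and optimality of the iterates\<close>

definition krylov :: "nat \<Rightarrow> (real^'n) set" where
  "krylov j = span (p ` {..<j})"

lemma krylov_0 [simp]: "krylov 0 = {0}"
  by (simp add: krylov_def)

lemma krylov_mono: "i \<le> j \<Longrightarrow> krylov i \<subseteq> krylov j"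
  unfolding krylov_def by (intro span_mono image_mono) auto

lemma subspace_krylov: "subspace (krylov j)"
  by (simp add: krylov_def)

lemma p_in_krylov: "i < j \<Longrightarrow> p i \<in> krylov j"
  unfolding krylov_def by (intro span_base) auto

lemma z_in_krylov:
  assumes "i \<le> k" "i < j"
  shows "z i \<in> krylov j"
proof (cases i)
  case 0
  then show ?thesis
    using p_in_krylov[of 0 j] assms by (simp add: p_0)
next
  case (Suc l)
  then have "z i = p i - \<beta> l *\<^sub>R p l"
    using assms by (simp add: p_Suc)
  then show ?thesis
    using Suc assms by (auto intro!: subspace_diff subspace_scale subspace_krylov p_in_krylov)
qed

text \<open>Spanning \<open>krylov\<close> by directions makes orthogonality immediate and leaves
  the Krylov property to be proved: as \<open>a i\<close> is nonzero, \<open>T *v p i\<close> is a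
  multiple of \<open>z i - z (Suc i)\<close>.\<close>

lemma T_krylov:
  assumes "j \<le> k" "u \<in> krylov j"
  shows "T *v u \<in> krylov (Suc j)"
proof -
  have "T *v p i \<in> krylov (Suc j)" if "i < j" for i
  proof -
    have "T *v p i = (1 / a i) *\<^sub>R (z i - z (Suc i))"
      using that assms(1) a_pos[of i] by (simp add: z_Suc)
    also have "\<dots> \<in> krylov (Suc j)"
      using that assms(1)
      by (intro subspace_scale subspace_diff subspace_krylov z_in_krylov) auto
    finally show ?thesis .
  qed
  then have "span ((*v) T ` p ` {..<j}) \<subseteq> krylov (Suc j)"
    by (intro span_minimal subspace_krylov) auto
  moreover have "T *v u \<in> (*v) T ` span (p ` {..<j})"
    using assms(2) by (auto simp: krylov_def)
  ultimately show ?thesis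
    by (auto simp: linear_span_image[OF matrix_vector_mul_linear])
qed

text \<open>The Galerkin condition: \<open>mip K (p i) (e k)\<close> equals
  \<open>mip N (p i) (z k)\<close>.\<close>

lemma e_orthogonal_krylov:
  assumes "u \<in> krylov k"
  shows "mip K u (e k) = 0"
proof -
  have "subspace {u. mip K u (e k) = 0}"
    by (auto simp: subspace_def mip_bilinear)
  moreover have "p ` {..<k} \<subseteq> {u. mip K u (e k) = 0}"
    using orthogonality[of k] z_eq[of k] mip_N_T by auto
  ultimately show ?thesis
    using assms span_minimal unfolding krylov_def by blast
qed

lemma e_diff_krylov: "j \<le> k \<Longrightarrow> e 0 - e j \<in> krylov j"
proof (induction j)
  case (Suc j)
  have "e 0 - e (Suc j) = (e 0 - e j) + a j *\<^sub>R p j"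
    using Suc.prems by (simp add: e_Suc)
  also have "\<dots> \<in> krylov (Suc j)"
    using Suc krylov_mono[of j "Suc j"]
    by (intro subspace_add subspace_scale subspace_krylov p_in_krylov) auto
  finally show ?case .
qed simp

text \<open>The coefficient of \<open>e 0\<close> in the polynomial applied to it is its value at \<open>T = 0\<close>, hence the
  scalar recurrence with \<open>s\<close> in place of \<open>Y = s - 2 T\<close>.\<close>
lemma cheb_krylov:
  assumes Y: "\<And>u. Y *v u = s *\<^sub>R u - 2 *\<^sub>R (T *v u)"
    and "j \<le> k" "cheb ((*v) Y) D (e 0) j = (c, u)" "cheb ((*) s) D 1 j = (\<gamma>, \<upsilon>)"
  shows "c - \<gamma> *\<^sub>R e 0 \<in> krylov j \<and> u - \<upsilon> *\<^sub>R e 0 \<in> krylov j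
    \<and> (Y *v u + c) - (s * \<upsilon> + \<gamma>) *\<^sub>R e 0 \<in> krylov j"
  using assms(2-)
proof (induction j arbitrary: c u \<gamma> \<upsilon>)
  case (Suc j)
  obtain c\<^sub>0 u\<^sub>0 where v: "cheb ((*v) Y) D (e 0) j = (c\<^sub>0, u\<^sub>0)"
    by fastforce
  obtain \<gamma>\<^sub>0 \<upsilon>\<^sub>0 where r: "cheb ((*) s) D 1 j = (\<gamma>\<^sub>0, \<upsilon>\<^sub>0)"
    by fastforce
  have u: "u = Y *v u\<^sub>0 + c\<^sub>0" "\<upsilon> = s * \<upsilon>\<^sub>0 + \<gamma>\<^sub>0"
    and c: "c = Y *v u - D *\<^sub>R u\<^sub>0" "\<gamma> = s * \<upsilon> - D * \<upsilon>\<^sub>0"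
    using Suc.prems v r by (auto simp: Let_def)
  \<comment> \<open>The third conjunct of the induction hypothesis concerns the new
    \<open>u\<close>. Its degree is one less than that of the new \<open>c\<close>, so
    \<open>krylov j\<close> suffices and applying \<open>Y\<close> stays within
    \<open>krylov (Suc j)\<close>.\<close>
  have IH: "u\<^sub>0 - \<upsilon>\<^sub>0 *\<^sub>R e 0 \<in> krylov j" "u - \<upsilon> *\<^sub>R e 0 \<in> krylov j"
    using Suc.IH[OF _ v r] Suc.prems(1) by (auto simp: u)
  have jk: "j \<le> k"
    using Suc.prems(1) by simp
  have mono: "w \<in> krylov j \<Longrightarrow> w \<in> krylov (Suc j)" for w
    using krylov_mono[of j "Suc j"] by auto
  have Te: "T *v e 0 \<in> krylov (Suc j)"
    using z_in_krylov[of 0 "Suc j"] z_eq[of 0] by simp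
  have "Y *v u - (s * \<upsilon>) *\<^sub>R e 0
      = s *\<^sub>R (u - \<upsilon> *\<^sub>R e 0) - 2 *\<^sub>R (T *v (u - \<upsilon> *\<^sub>R e 0)) - (2 * \<upsilon>) *\<^sub>R (T *v e 0)"
    by (simp add: Y matrix_vector_mult_diff_distrib matrix_vector_mult_scaleR algebra_simps)
  also have "\<dots> \<in> krylov (Suc j)"
    by (rule subspace_diff[OF subspace_krylov subspace_diff[OF subspace_krylov
            subspace_scale[OF subspace_krylov mono[OF IH(2)]]
            subspace_scale[OF subspace_krylov T_krylov[OF jk IH(2)]]]
          subspace_scale[OF subspace_krylov Te]])
  finally have Yu: "Y *v u - (s * \<upsilon>) *\<^sub>R e 0 \<in> krylov (Suc j)" .
  have "c - \<gamma> *\<^sub>R e 0 = (Y *v u - (s * \<upsilon>) *\<^sub>R e 0) - D *\<^sub>R (u\<^sub>0 - \<upsilon>\<^sub>0 *\<^sub>R e 0)"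
    by (simp add: c algebra_simps)
  also have "\<dots> \<in> krylov (Suc j)"
    by (rule subspace_diff[OF subspace_krylov Yu
          subspace_scale[OF subspace_krylov mono[OF IH(1)]]])
  finally have ce: "c - \<gamma> *\<^sub>R e 0 \<in> krylov (Suc j)" .
  have "(Y *v u + c) - (s * \<upsilon> + \<gamma>) *\<^sub>R e 0
      = (Y *v u - (s * \<upsilon>) *\<^sub>R e 0) + (c - \<gamma> *\<^sub>R e 0)"
    by (simp add: algebra_simps)
  also have "\<dots> \<in> krylov (Suc j)"
    by (rule subspace_add[OF subspace_krylov Yu ce])
  finally show ?case
    using ce mono[OF IH(2)] by blast
qed auto

text \<open>Pythagoras: \<open>c - \<gamma> *\<^sub>R e k\<close> lies in \<open>krylov k\<close>
  and so is \<open>K\<close>-orthogonal to \<open>e k\<close>. Keeping \<open>\<gamma>\<close>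
  avoids normalising the polynomial at 0.\<close>

lemma cg_optimal:
  assumes "c - \<gamma> *\<^sub>R e 0 \<in> krylov k"
  shows "\<gamma>\<^sup>2 * mip K (e k) (e k) \<le> mip K c c"
proof -
  define w where "w = c - \<gamma> *\<^sub>R e k"
  have "w = (c - \<gamma> *\<^sub>R e 0) + \<gamma> *\<^sub>R (e 0 - e k)"
    by (simp add: w_def algebra_simps)
  also have "\<dots> \<in> krylov k"
    using assms e_diff_krylov[of k] by (intro subspace_add subspace_scale subspace_krylov) auto
  finally have "mip K w (e k) = 0"
    by (rule e_orthogonal_krylov)
  moreover have "c = \<gamma> *\<^sub>R e k + w"
    by (simp add: w_def)
  ultimately have "mip K c c = \<gamma>\<^sup>2 * mip K (e k) (e k) + mip K w w"
    using spd_commute[OF K, of w "e k"] by (simp add: mip_bilinear power2_eq_square)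
  then show ?thesis
    using spd_nonneg[OF K, of w] by simp
qed

section \<open>Chebyshev rate from spectral bounds\<close>

lemma energy_bound:
  fixes \<sigma> \<tau> :: real
  assumes \<sigma>\<tau>: "0 < \<sigma>" "\<sigma> \<le> \<tau>"
    and lower: "\<And>u. \<sigma>\<^sup>2 * mip K u u \<le> mip K u (T *v u)"
    and upper: "\<And>u. mip K u (T *v u) \<le> \<tau>\<^sup>2 * mip K u u"
  shows "energy_norm K (e k) \<le> 2 * ((\<tau> - \<sigma>) / (\<tau> + \<sigma>)) ^ k * energy_norm K (e 0)"
proof -
  \<comment> \<open>The map from \<open>T\<close> to \<open>Y\<close> sends the interval from
    \<open>\<sigma>\<^sup>2\<close> to \<open>\<tau>\<^sup>2\<close> onto that from
    \<open>- d\<close> to \<open>d\<close>, and 0 to \<open>s\<close>.\<close>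
  define s where "s = \<tau>\<^sup>2 + \<sigma>\<^sup>2"
  define d where "d = \<tau>\<^sup>2 - \<sigma>\<^sup>2"
  define Y where "Y = s *\<^sub>R mat 1 - 2 *\<^sub>R T"
  have d: "0 \<le> d"
    using \<sigma>\<tau> by (simp add: d_def)
  have Y: "Y *v u = s *\<^sub>R u - 2 *\<^sub>R (T *v u)" for u
    by (simp add: Y_def matrix_vector_mult_diff_rdistrib flip: scaleR_matrix_vector_assoc)
  have sym: "transpose (K ** Y) = K ** Y"
  proof -
    have "K ** Y = s *\<^sub>R K - 2 *\<^sub>R (K ** T)"
      by (intro matrix_eq[THEN iffD2])
        (simp add: Y matrix_vector_mul_assoc[symmetric] matrix_vector_mult_diff_rdistrib
          matrix_vector_mult_diff_distrib matrix_vector_mult_scaleR flip: scaleR_matrix_vector_assoc)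
    then show ?thesis
      using K T_selfadjoint by (simp add: spd_def transpose_def vec_eq_iff)
  qed
  have contraction: "mip K (Y *v u) (Y *v u) \<le> d\<^sup>2 * mip K u u" for u
  proof (rule selfadjoint_norm_le[OF K sym d])
    show "\<bar>mip K u (Y *v u)\<bar> \<le> d * mip K u u" for u
      using lower[of u] upper[of u]
      by (simp add: Y mip_bilinear abs_le_iff s_def d_def algebra_simps)
  qed
  obtain c u where v: "cheb ((*v) Y) (d\<^sup>2) (e 0) k = (c, u)"
    by fastforce
  obtain \<gamma> \<upsilon> where r: "cheb ((*) s) (d\<^sup>2) 1 k = (\<gamma>, \<upsilon>)"
    by fastforce
  have "\<gamma>\<^sup>2 * mip K (e k) (e k) \<le> mip K c c"
    using cheb_krylov[OF Y order_refl v r] by (intro cg_optimal) simp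
  also have "\<dots> \<le> (d\<^sup>2) ^ k * mip K (e 0) (e 0)"
    using cheb_pell[OF K sym v] contraction[of u] by simp
  finally have "sqrt (\<gamma>\<^sup>2 * mip K (e k) (e k)) \<le> sqrt ((d ^ k)\<^sup>2 * mip K (e 0) (e 0))"
    by (simp add: power_mult[symmetric] mult.commute)
  then have main: "\<bar>\<gamma>\<bar> * energy_norm K (e k) \<le> d ^ k * energy_norm K (e 0)"
    using d by (simp add: real_sqrt_mult energy_norm_def mip_def)
  \<comment> \<open>\<open>2 * \<sigma> * \<tau>\<close> is a square root of
    \<open>s\<^sup>2 - d\<^sup>2\<close>, and adding it to or subtracting it from \<open>s\<close>
    gives a perfect square.\<close>
  have "\<gamma> + 2 * \<sigma> * \<tau> * \<upsilon> = ((\<tau> + \<sigma>)\<^sup>2) ^ k"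
    using cheb_real[OF _ r, of "2 * \<sigma> * \<tau>"]
    by (simp add: s_def d_def power2_eq_square algebra_simps)
  moreover have "\<gamma> - 2 * \<sigma> * \<tau> * \<upsilon> = ((\<tau> - \<sigma>)\<^sup>2) ^ k"
    using cheb_real[OF _ r, of "- (2 * \<sigma> * \<tau>)"]
    by (simp add: s_def d_def power2_eq_square algebra_simps)
  moreover have "0 \<le> ((\<tau> - \<sigma>)\<^sup>2) ^ k"
    by simp
  ultimately have \<gamma>: "((\<tau> + \<sigma>)\<^sup>2) ^ k \<le> 2 * \<gamma>"
    by linarith
  have pos: "0 < (\<tau> + \<sigma>) ^ k"
    using \<sigma>\<tau> by simp
  have "((\<tau> + \<sigma>)\<^sup>2) ^ k * energy_norm K (e k) \<le> 2 * (d ^ k * energy_norm K (e 0))"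
    using mult_right_mono[OF \<gamma>, of "energy_norm K (e k)"] main spd_nonneg[OF K, of "e k"]
      mult_right_mono[OF abs_ge_self[of \<gamma>], of "energy_norm K (e k)"]
    by (simp add: energy_norm_def mip_def)
  \<comment> \<open>Factoring \<open>d\<close> lets one power of \<open>\<tau> + \<sigma>\<close>
    cancel.\<close>
  also have "d ^ k = (\<tau> + \<sigma>) ^ k * (\<tau> - \<sigma>) ^ k"
    by (simp add: d_def power2_eq_square algebra_simps flip: power_mult_distrib)
  finally have "(\<tau> + \<sigma>) ^ k * ((\<tau> + \<sigma>) ^ k * energy_norm K (e k))
      \<le> (\<tau> + \<sigma>) ^ k * (2 * (\<tau> - \<sigma>) ^ k * energy_norm K (e 0))"
    by (simp add: power2_eq_square power_mult_distrib mult_ac)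
  then show ?thesis
    using pos by (simp add: power_divide field_simps)
qed

end

section \<open>RPCG as preconditioned conjugate gradients\<close>

theorem theorem2p5:
  fixes A P Q H G M W :: "real^'n^'n"
    and b x_star :: "real^'n"
    and x r z v p q :: "nat \<Rightarrow> real^'n"
    and \<alpha> \<beta> :: "nat \<Rightarrow> real"
    and k :: nat
  assumes "invertible A" and "invertible P" and "invertible Q"
    and "spd H" and "A = P ** H ** Q"
    and "spd G" and "M = P ** G ** Q"
    and "W = matrix_inv Q ** transpose P"
    and "A *v x_star = b"
    and "rpcg_run A M W b k x r z v p q \<alpha> \<beta>"
  shows "energy_norm (transpose (matrix_inv W) ** A) (x k - x_star)
    \<le> 2 * ((sqrt (cond2 (matrix_inv M ** A)) - 1) / (sqrt (cond2 (matrix_inv M ** A)) + 1)) ^ k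
        * energy_norm (transpose (matrix_inv W) ** A) (x 0 - x_star)"
proof -
  define V where "V = matrix_inv W"
  define K where "K = transpose V ** A"
  define N where "N = transpose V ** M"
  define T where "T = matrix_inv M ** A"
  \<comment> \<open>This sign gives \<open>r j = A *v e j\<close>; the energy norm is
    unaffected.\<close>
  define e where "e j = x_star - x j" for j
  have inv: "matrix_inv X ** X = mat 1" "X ** matrix_inv X = mat 1"
    if "invertible X" for X :: "real^'n^'n"
    using someI_ex[OF that[unfolded invertible_def]] by (simp_all add: matrix_inv_def)
  have invP: "invertible (transpose P)"
    using assms(2) by (rule transpose_invertible)
  have invW: "invertible W"
    using assms(3,8) invP by (metis inv invertible_def invertible_mult)
  have "V = matrix_inv (transpose P) ** Q"
  proof -
    have "W ** (matrix_inv (transpose P) ** Q)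
        = matrix_inv Q ** (transpose P ** matrix_inv (transpose P)) ** Q"
      by (simp add: assms(8) matrix_mul_assoc)
    also have "\<dots> = mat 1"
      using inv(1)[OF assms(3)] inv(2)[OF invP] by simp
    finally show ?thesis
      unfolding V_def using inv(1)[OF invW]
      by (metis matrix_mul_assoc matrix_mul_lid matrix_mul_rid)
  qed
  then have "transpose P ** V = Q"
    using inv(2)[OF invP] by (simp add: matrix_mul_assoc)
  \<comment> \<open>This turns \<open>K\<close> into \<open>transpose Q ** H ** Q\<close> and
    \<open>N\<close> into \<open>transpose Q ** G ** Q\<close>.\<close>
  then have VP: "transpose V ** P = transpose Q"
    by (metis matrix_transpose_mul transpose_transpose)
  have K: "spd K" and N: "spd N"
    using spd_congruence[OF assms(4,3)] spd_congruence[OF assms(6,3)]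
    by (simp_all add: K_def N_def assms(5,7) matrix_mul_assoc VP)
  have invG: "invertible G"
    using spd_inj[OF assms(6)]
    by (metis inj_def invertible_left_inverse matrix_left_invertible_injective)
  have invM: "invertible M"
    using assms(2,3,7) invG by (simp add: invertible_mult)
  have NT: "N ** T = K"
    using inv(2)[OF invM] unfolding N_def T_def K_def
    by (metis matrix_mul_assoc matrix_mul_lid)
  have invT: "invertible T"
    using assms(1) invM unfolding T_def by (metis inv invertible_def invertible_mult)
  note run = assms(10)[unfolded rpcg_run_def]
  have r: "j \<le> k \<Longrightarrow> r j = A *v e j" for j
  proof (induction j)
    case 0
    then show ?case
      using run assms(9) by (simp add: e_def matrix_vector_mult_diff_distrib)
  next
    case (Suc j)
    then show ?case
      using run by (simp add: e_def matrix_vector_mult_diff_distrib matrix_vector_right_distrib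
          matrix_vector_mult_scaleR)
  qed
  have z: "z j = matrix_inv M *v r j" and v: "v j = V *v z j" if "j \<le> k" for j
    using that run by (cases j; simp add: V_def)+
  \<comment> \<open>Hence \<open>q j \<bullet> (A *v p j)\<close> is
    \<open>mip K (p j) (p j)\<close>.\<close>
  have q: "j \<le> k \<Longrightarrow> q j = V *v p j" for j
  proof (induction j)
    case 0
    then show ?case
      using run by (simp add: V_def)
  next
    case (Suc j)
    then show ?case
      using run v[of "Suc j"]
      by (simp add: matrix_vector_right_distrib matrix_vector_mult_scaleR)
  qed
  have Mz: "r j = M *v z j" if "j \<le> k" for j
    using z[OF that] inv(2)[OF invM] by (simp add: matrix_vector_mul_assoc)
  have V_form: "(V *v u) \<bullet> (X *v w) = mip (transpose V ** X) u w" for X u w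
    by (metis mip_mult mip_def dot_lmul_matrix transpose_matrix_vector transpose_transpose)
  have vr: "v j \<bullet> r j = mip N (z j) (z j)" if "j \<le> k" for j
    using that v Mz[OF that] by (simp add: V_form N_def)
  \<comment> \<open>RPCG's \<open>\<alpha>\<close> is the negative of the usual step length.\<close>
  interpret preconditioned_cg K N T k e z p "\<lambda>j. - \<alpha> j" \<beta>
  proof
    show "z j = T *v e j" if "j \<le> k" for j
      using that by (simp add: z r T_def matrix_vector_mul_assoc)
    show "e j \<noteq> 0" if "j < k" for j
      using run that r[of j] by auto
    show "- \<alpha> j = mip N (z j) (z j) / mip K (p j) (p j)" if "j < k" for j
      using run that vr[of j] q[of j] by (simp add: V_form K_def)
    show "e (Suc j) = e j - (- \<alpha> j) *\<^sub>R p j" if "j < k" for j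
      using run that by (simp add: e_def)
    show "\<beta> j = mip N (z (Suc j)) (z (Suc j)) / mip N (z j) (z j)" if "j < k" for j
      using run that vr[of j] vr[of "Suc j"] by simp
  qed (use K N NT run in auto)
  define S where "S = matrix_inv T"
  define \<mu> where "\<mu> = onorm ((*v) S)"
  define \<nu> where "\<nu> = onorm ((*v) T)"
  have lower: "mip K u u \<le> \<mu> * mip K u (T *v u)" for u
    unfolding \<mu>_def using inv(1)[OF invT]
    by (intro selfadjoint_ge_onorm_inverse[OF K T_selfadjoint T_pos]) (simp add: S_def)
  have upper: "mip K u (T *v u) \<le> \<nu> * mip K u u" for u
    unfolding \<nu>_def by (rule selfadjoint_le_onorm[OF K T_selfadjoint])
  obtain w :: "real^'n" where "norm w = 1"
    using vector_choose_size[of 1] by auto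
  then have w: "0 < mip K w w"
    by (intro spd_pos[OF K]) auto
  have "0 \<le> \<mu>"
    unfolding \<mu>_def by (intro onorm_pos_le matrix_vector_mul_bounded_linear)
  then have \<mu>: "0 < \<mu>"
    using w lower[of w] by (cases "\<mu> = 0") auto
  have "1 * mip K w w \<le> \<mu> * \<nu> * mip K w w"
    using order_trans[OF lower[of w] mult_left_mono[OF upper[of w] less_imp_le[OF \<mu>]]]
    by (simp add: mult_ac)
  then have \<mu>\<nu>: "1 \<le> \<mu> * \<nu>"
    using w by simp
  then have \<nu>: "0 < \<nu>"
    using \<mu> by (metis less_le_trans zero_less_mult_pos zero_less_one)
  \<comment> \<open>Here \<open>\<sigma> = 1 / sqrt \<mu>\<close> and
    \<open>\<tau> = sqrt \<nu>\<close>; expanding the fraction by \<open>sqrt \<mu>\<close> then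
    produces the condition number.\<close>
  have "energy_norm K (e k) \<le> 2 * ((sqrt \<nu> - 1 / sqrt \<mu>) / (sqrt \<nu> + 1 / sqrt \<mu>)) ^ k
      * energy_norm K (e 0)"
  proof (rule energy_bound)
    show "1 / sqrt \<mu> \<le> sqrt \<nu>"
      using \<mu> \<mu>\<nu> by (simp add: divide_le_eq flip: real_sqrt_mult) (simp add: mult.commute)
    show "(1 / sqrt \<mu>)\<^sup>2 * mip K u u \<le> mip K u (T *v u)" for u
      using \<mu> lower[of u] by (simp add: power_divide divide_le_eq mult.commute)
    show "mip K u (T *v u) \<le> (sqrt \<nu>)\<^sup>2 * mip K u u" for u
      using \<nu> upper[of u] by simp
  qed (use \<mu> in simp)
  also have "(sqrt \<nu> - 1 / sqrt \<mu>) / (sqrt \<nu> + 1 / sqrt \<mu>)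
      = (sqrt (\<nu> * \<mu>) - 1) / (sqrt (\<nu> * \<mu>) + 1)"
  proof -
    have "sqrt \<nu> - 1 / sqrt \<mu> = (sqrt (\<nu> * \<mu>) - 1) / sqrt \<mu>"
      "sqrt \<nu> + 1 / sqrt \<mu> = (sqrt (\<nu> * \<mu>) + 1) / sqrt \<mu>"
      using \<mu> by (simp_all add: real_sqrt_mult field_simps)
    then show ?thesis
      using \<mu> by simp
  qed
  also have "\<nu> * \<mu> = cond2 T"
    by (simp add: cond2_def \<mu>_def \<nu>_def S_def)
  finally have "energy_norm K (e k)
      \<le> 2 * ((sqrt (cond2 T) - 1) / (sqrt (cond2 T) + 1)) ^ k * energy_norm K (e 0)" .
  moreover have "energy_norm K (e j) = energy_norm K (x j - x_star)" for j
    by (simp add: energy_norm_def e_def matrix_vector_mult_diff_distrib inner_diff_left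
        inner_diff_right algebra_simps)
  ultimately show ?thesis
    by (simp add: K_def V_def T_def)
qed

end
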